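(* Let $G_1,G_2$ be finite groups and let $L=(\theta\colon P_1/K_1\to P_2/K_2)$ and $L'=(\theta'\colon P_1'/K_1'\to P_2'/K_2')$ be subgroups of $G_1\times G_2$ with $L'\leq L$. Define a map $\hat\theta'\colon P_1'/(P_1'\cap K_1)\to P_2'/(P_2'\cap K_2)$ by $(p_1(P_1'\cap K_1))^{\hat\theta'}=p_2(P_2'\cap K_2)$ whenever $p_i\in P_i'$ are such that $(p_1K_1')^{\theta'}=p_2K_2'$, and a map $\tilde\theta\colon P_1'K_1/K_1\to P_2'K_2/K_2$ by $(p_1K_1)^{\tilde\theta}=p_2K_2$ whenever $p_i\in P_i'$ are such that $(p_1K_1)^\theta=p_2K_2$. Then: (i) $\hat\theta'$ and $\tilde\theta$ are isomorphisms, with corresponding graphs $L_{\hat\theta'}$ and $L_{\tilde\theta}\leq G_1\times G_2$. (ii) $L_{\hat\theta'}$ and $L_{\tilde\theta}$ are the unique subgroups of $G_1\times G_2$ with $$L'\leq_P L_{\hat\theta'}\leq_{P/K} L_{\tilde\theta}\leq_K L.$$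
   Context: Homomorphisms act from the right. A section of a group $G$ is a pair $(P,K)$ of subgroups with $K\trianglelefteq P$. By Goursat's Lemma, subgroups $L$ of $G_1\times G_2$ correspond bijectively to isomorphisms $\theta\colon P_1/K_1\to P_2/K_2$ with $(P_i,K_i)$ a section of $G_i$, via $L=\{(a_1,a_2)\in P_1\times P_2 : (a_1K_1)^\theta=a_2K_2\}$, the graph of $\theta$; we write $L=(\theta\colon P_1/K_1\to P_2/K_2)$. Here $P_i$ is the projection of $L$ to $G_i$ and $K_1=\{a_1:(a_1,1)\in L\}$, $K_2=\{a_2:(1,a_2)\in L\}$. For subgroups $L=(\theta\colon P_1/K_1\to P_2/K_2)$ and $L'=(\theta'\colon P_1'/K_1'\to P_2'/K_2')$ of $G_1\times G_2$ with $L'\leq L$ one has $P_i'\leq P_i$ and $K_i'\leq K_i$, $i=1,2$, and one writes: $L'\leq_P L$ if $P_i'=P_i$ for $i=1,2$; $L'\leq_K L$ if $K_i'=K_i$ for $i=1,2$; $L'\leq_{P/K}L$ if the canonical homomorphisms $P_i'/K_i'\to P_i/K_i$, $pK_i'\mapsto pK_i$, are isomorphisms for $i=1,2$. (The subscripts $P$, $K$, $P/K$ are just names of the relations.) *)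

theory Defs
  imports "HOL-Algebra.Algebra"
begin

text \<open>
  Cosets are written as in HOL-Algebra, i.e. as right cosets \<open>K #> p\<close>; in every quotient
  \<open>P/K\<close> below, \<open>K\<close> is normal in \<open>P\<close>, so that this is the coset \<open>pK\<close>.
\<close>

definition is_section :: "('a, 'm) monoid_scheme \<Rightarrow> 'a set \<Rightarrow> 'a set \<Rightarrow> bool" where
  "is_section G P K \<longleftrightarrow> subgroup P G \<and> subgroup K G \<and> K \<lhd> (G\<lparr>carrier := P\<rparr>)"

abbreviation quot :: "('a, 'm) monoid_scheme \<Rightarrow> 'a set \<Rightarrow> 'a set \<Rightarrow> 'a set monoid" where
  "quot G P K \<equiv> (G\<lparr>carrier := P\<rparr>) Mod K"

definition graph_of ::
  "('a, 'm) monoid_scheme \<Rightarrow> ('b, 'n) monoid_scheme \<Rightarrow> 'a set \<Rightarrow> 'a set \<Rightarrow> 'b set \<Rightarrow> 'b set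
    \<Rightarrow> ('a set \<Rightarrow> 'b set) \<Rightarrow> ('a \<times> 'b) set" where
  "graph_of G1 G2 P1 K1 P2 K2 \<theta> =
    {(a1, a2) \<in> P1 \<times> P2. \<theta> (K1 #>\<^bsub>G1\<^esub> a1) = K2 #>\<^bsub>G2\<^esub> a2}"

definition section_iso ::
  "('a, 'm) monoid_scheme \<Rightarrow> ('b, 'n) monoid_scheme \<Rightarrow> 'a set \<Rightarrow> 'a set \<Rightarrow> 'b set \<Rightarrow> 'b set
    \<Rightarrow> ('a set \<Rightarrow> 'b set) \<Rightarrow> bool" where
  "section_iso G1 G2 P1 K1 P2 K2 \<theta> \<longleftrightarrow>
    is_section G1 P1 K1 \<and> is_section G2 P2 K2 \<and> \<theta> \<in> iso (quot G1 P1 K1) (quot G2 P2 K2)"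

definition ker1 :: "('b, 'n) monoid_scheme \<Rightarrow> ('a \<times> 'b) set \<Rightarrow> 'a set" where
  "ker1 G2 L = {a1. (a1, \<one>\<^bsub>G2\<^esub>) \<in> L}"

definition ker2 :: "('a, 'm) monoid_scheme \<Rightarrow> ('a \<times> 'b) set \<Rightarrow> 'b set" where
  "ker2 G1 L = {a2. (\<one>\<^bsub>G1\<^esub>, a2) \<in> L}"

text \<open>
  The map sending the coset of \<open>p\<close> modulo \<open>N\<close> to the coset of \<open>q\<close> modulo \<open>M\<close> whenever
  \<open>R p q\<close>. It is meaningful at a coset only if \<open>R\<close> determines exactly one image there.
\<close>

definition coset_map ::
  "('a, 'm) monoid_scheme \<Rightarrow> 'a set \<Rightarrow> ('b, 'n) monoid_scheme \<Rightarrow> 'b set \<Rightarrow> ('a \<Rightarrow> 'b \<Rightarrow> bool)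
    \<Rightarrow> 'a set \<Rightarrow> 'b set" where
  "coset_map G N H M R C =
    (THE D. \<exists>p q. R p q \<and> C = N #>\<^bsub>G\<^esub> p \<and> D = M #>\<^bsub>H\<^esub> q)"

definition canonical_map ::
  "('a, 'm) monoid_scheme \<Rightarrow> 'a set \<Rightarrow> 'a set \<Rightarrow> 'a set \<Rightarrow> 'a set \<Rightarrow> 'a set" where
  "canonical_map G P' K' K = coset_map G K' G K (\<lambda>p q. p \<in> P' \<and> q = p)"

definition le_P :: "('a \<times> 'b) set \<Rightarrow> ('a \<times> 'b) set \<Rightarrow> bool" where
  "le_P L' L \<longleftrightarrow> L' \<subseteq> L \<and> fst ` L' = fst ` L \<and> snd ` L' = snd ` L"

definition le_K ::
  "('a, 'm) monoid_scheme \<Rightarrow> ('b, 'n) monoid_scheme \<Rightarrow> ('a \<times> 'b) set \<Rightarrow> ('a \<times> 'b) set \<Rightarrow> bool" where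
  "le_K G1 G2 L' L \<longleftrightarrow> L' \<subseteq> L \<and> ker1 G2 L' = ker1 G2 L \<and> ker2 G1 L' = ker2 G1 L"

definition le_PK ::
  "('a, 'm) monoid_scheme \<Rightarrow> ('b, 'n) monoid_scheme \<Rightarrow> ('a \<times> 'b) set \<Rightarrow> ('a \<times> 'b) set \<Rightarrow> bool" where
  "le_PK G1 G2 L' L \<longleftrightarrow> L' \<subseteq> L
    \<and> canonical_map G1 (fst ` L') (ker1 G2 L') (ker1 G2 L)
        \<in> iso (quot G1 (fst ` L') (ker1 G2 L')) (quot G1 (fst ` L) (ker1 G2 L))
    \<and> canonical_map G2 (snd ` L') (ker2 G1 L') (ker2 G1 L)
        \<in> iso (quot G2 (snd ` L') (ker2 G1 L')) (quot G2 (snd ` L) (ker2 G1 L))"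

definition theta_hat ::
  "('a, 'm) monoid_scheme \<Rightarrow> ('b, 'n) monoid_scheme \<Rightarrow> 'a set \<Rightarrow> 'b set
    \<Rightarrow> 'a set \<Rightarrow> 'a set \<Rightarrow> 'b set \<Rightarrow> 'b set \<Rightarrow> ('a set \<Rightarrow> 'b set) \<Rightarrow> 'a set \<Rightarrow> 'b set" where
  "theta_hat G1 G2 K1 K2 P1' K1' P2' K2' \<theta>' =
    coset_map G1 (P1' \<inter> K1) G2 (P2' \<inter> K2)
      (\<lambda>p1 p2. p1 \<in> P1' \<and> p2 \<in> P2' \<and> \<theta>' (K1' #>\<^bsub>G1\<^esub> p1) = K2' #>\<^bsub>G2\<^esub> p2)"

definition theta_tilde ::
  "('a, 'm) monoid_scheme \<Rightarrow> ('b, 'n) monoid_scheme \<Rightarrow> 'a set \<Rightarrow> 'b set \<Rightarrow> ('a set \<Rightarrow> 'b set)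
    \<Rightarrow> 'a set \<Rightarrow> 'b set \<Rightarrow> 'a set \<Rightarrow> 'b set" where
  "theta_tilde G1 G2 K1 K2 \<theta> P1' P2' =
    coset_map G1 K1 G2 K2
      (\<lambda>p1 p2. p1 \<in> P1' \<and> p2 \<in> P2' \<and> \<theta> (K1 #>\<^bsub>G1\<^esub> p1) = K2 #>\<^bsub>G2\<^esub> p2)"

end

theory Submission
  imports Defs
begin

text \<open>
  The two middle groups are cut out of \<open>L\<close> by rectangles: the graphs of the two maps are
  \<open>L \<inter> (P1' \<times> P2')\<close> and \<open>L \<inter> (P1'K1 \<times> P2'K2)\<close>. Their projections and kernels are read off directly,
  and Goursat's lemma then identifies the isomorphisms. The relation \<open>\<le>\<^sub>P\<^sub>/\<^sub>K\<close> is the second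
  isomorphism theorem; conversely, injectivity and surjectivity of the canonical maps force the
  projections and kernels of any other chain, and nested subgroups of \<open>G1 \<times> G2\<close> with equal first
  projection and equal second kernel coincide.
\<close>

section \<open>Cosets, sections and products in a single group\<close>

lemma coset_map_eqI:
  assumes "R p q"
    and "\<And>p' q'. R p' q' \<Longrightarrow> N #>\<^bsub>G\<^esub> p' = N #>\<^bsub>G\<^esub> p \<Longrightarrow> M #>\<^bsub>H\<^esub> q' = M #>\<^bsub>H\<^esub> q"
  shows "coset_map G N H M R (N #>\<^bsub>G\<^esub> p) = M #>\<^bsub>H\<^esub> q"
  unfolding coset_map_def using assms by (intro the_equality) metis+

text \<open>Cosets, like the set products below, involve only the multiplication, which a change of
  carrier leaves alone. Facts about the structure with carrier \<open>P\<close> can thus be read in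
  \<open>G\<close>.\<close>

lemma r_coset_carrier_update [simp]: "K #>\<^bsub>G\<lparr>carrier := P\<rparr>\<^esub> a = K #>\<^bsub>G\<^esub> a"
  by (simp add: r_coset_def)

lemma set_mult_carrier_update [simp]: "A <#>\<^bsub>G\<lparr>carrier := P\<rparr>\<^esub> B = A <#>\<^bsub>G\<^esub> B"
  by (simp add: set_mult_def)

lemma quot_carrier: "carrier (quot G P K) = (\<lambda>a. K #>\<^bsub>G\<^esub> a) ` P"
  by (auto simp: FactGroup_def RCOSETS_def)

context group
begin

lemma r_coset_eq_iff:
  assumes "subgroup K G" "a \<in> carrier G" "b \<in> carrier G"
  shows "K #> a = K #> b \<longleftrightarrow> a \<otimes> inv b \<in> K"
proof
  assume "K #> a = K #> b"
  then have "a \<in> K #> b" using rcos_self[OF assms(2,1)] by simp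
  then obtain k where "k \<in> K" "a = k \<otimes> b" by (auto simp: r_coset_def)
  then show "a \<otimes> inv b \<in> K"
    using assms by (simp add: m_assoc subgroup.mem_carrier)
next
  assume k: "a \<otimes> inv b \<in> K"
  have "a = (a \<otimes> inv b) \<otimes> b" using assms by (simp add: m_assoc)
  then have "a \<in> K #> b" using k unfolding r_coset_def by blast
  then show "K #> a = K #> b" using repr_independence[OF _ assms(3,1)] by simp
qed

lemma r_coset_mult:
  assumes "is_section G P K" "a \<in> P" "b \<in> P"
  shows "(K #> a) <#> (K #> b) = K #> (a \<otimes> b)"
  using normal.rcos_sum[of K "G\<lparr>carrier := P\<rparr>" a b] assms by (simp add: is_section_def)

lemma section_conj:
  assumes "is_section G P K" "a \<in> P" "k \<in> K"
  shows "a \<otimes> k \<otimes> inv a \<in> K"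
  using normal.inv_op_closed2[of K "G\<lparr>carrier := P\<rparr>" a k] assms
  by (simp add: is_section_def m_inv_consistent)

text \<open>Normality in \<open>is_section\<close> lives in the structure with carrier
  \<open>P\<close>. Inverses there agree with those of \<open>G\<close>, so conjugation can be
  tested in \<open>G\<close> itself.\<close>

lemma is_sectionI:
  assumes "subgroup P G" "subgroup K G" "K \<subseteq> P"
    and "\<And>a k. a \<in> P \<Longrightarrow> k \<in> K \<Longrightarrow> a \<otimes> k \<otimes> inv a \<in> K"
  shows "is_section G P K"
proof -
  interpret P: group "G\<lparr>carrier := P\<rparr>" using assms(1) by (rule subgroup_imp_group)
  have "subgroup K (G\<lparr>carrier := P\<rparr>)" using assms(1-3) by (intro subgroup_incl)
  then show ?thesis
    using assms by (simp add: is_section_def P.normal_inv_iff m_inv_consistent)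
qed

lemma section_subset: "is_section G P K \<Longrightarrow> K \<subseteq> P"
  using normal_imp_subgroup subgroup.subset unfolding is_section_def by fastforce

lemma set_mult_subset_left:
  assumes "subgroup Q G" "subgroup K G"
  shows "Q \<subseteq> Q <#> K"
  using assms by (force simp: set_mult_def subgroup.mem_carrier intro: subgroup.one_closed)

lemma set_mult_subset_right:
  assumes "subgroup Q G" "subgroup K G"
  shows "K \<subseteq> Q <#> K"
  using assms by (force simp: set_mult_def subgroup.mem_carrier intro: subgroup.one_closed)

text \<open>Since \<open>K\<close> is normal in \<open>P\<close>, the left cosets \<open>pK\<close>
  with \<open>p\<close> in \<open>Q\<close> are right cosets, and their union is the product. This
  supplies a representative in \<open>Q\<close> for each element of \<open>QK\<close>.\<close>

lemma mem_set_mult_iff_r_coset: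
  assumes "is_section G P K" "Q \<subseteq> P"
  shows "a \<in> Q <#> K \<longleftrightarrow> (\<exists>p \<in> Q. a \<in> K #> p)"
proof -
  have "l_coset G p K = K #> p" if "p \<in> Q" for p
    using that assms normal.coset_eq[of K "G\<lparr>carrier := P\<rparr>"]
    by (auto simp: is_section_def l_coset_def)
  moreover have "a \<in> Q <#> K \<longleftrightarrow> (\<exists>p \<in> Q. a \<in> l_coset G p K)"
    by (auto simp: set_mult_def l_coset_def)
  ultimately show ?thesis by simp
qed

text \<open>Normality of \<open>K\<close> is given relative to \<open>P\<close>, so the product is
  first shown to be a subgroup there and then transferred to \<open>G\<close>.\<close>

lemma section_set_mult:
  assumes s: "is_section G P K" and Q: "subgroup Q G" "Q \<subseteq> P"
  shows "is_section G (Q <#> K) K" "Q <#> K \<subseteq> P"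
proof -
  have P: "subgroup P G" and K: "subgroup K G" and n: "K \<lhd> G\<lparr>carrier := P\<rparr>"
    using s by (auto simp: is_section_def)
  interpret P: group "G\<lparr>carrier := P\<rparr>" using P by (rule subgroup_imp_group)
  have q: "subgroup Q (G\<lparr>carrier := P\<rparr>)" using Q P by (intro subgroup_incl)
  have "subgroup (Q <#> K) (G\<lparr>carrier := P\<rparr>)"
    using P.mult_norm_subgroup[OF n q] P.commut_normal[OF q n] by simp
  then show sub: "Q <#> K \<subseteq> P" using subgroup.subset by fastforce
  from \<open>subgroup (Q <#> K) (G\<lparr>carrier := P\<rparr>)\<close> have "subgroup (Q <#> K) G"
    using P by (rule incl_subgroup[rotated])
  then show "is_section G (Q <#> K) K"
    using K set_mult_subset_right[OF Q(1) K] section_conj[OF s] sub by (intro is_sectionI) auto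
qed

end

section \<open>Goursat's lemma for subgroups of a direct product\<close>

locale group_pair = G1: group G1 + G2: group G2
  for G1 :: "('a, 'm) monoid_scheme" and G2 :: "('b, 'n) monoid_scheme"
begin

lemma subgroup_mult:
  assumes "subgroup M (G1 \<times>\<times> G2)" "(a, b) \<in> M" "(c, d) \<in> M"
  shows "(a \<otimes>\<^bsub>G1\<^esub> c, b \<otimes>\<^bsub>G2\<^esub> d) \<in> M"
  using subgroup.m_closed[OF assms] by simp

lemma subgroup_one: "subgroup M (G1 \<times>\<times> G2) \<Longrightarrow> (\<one>\<^bsub>G1\<^esub>, \<one>\<^bsub>G2\<^esub>) \<in> M"
  using subgroup.one_closed by fastforce

lemma subgroup_carrier:
  assumes "subgroup M (G1 \<times>\<times> G2)" "(a, b) \<in> M"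
  shows "a \<in> carrier G1" "b \<in> carrier G2"
  using subgroup.mem_carrier[OF assms] by auto

lemma subgroup_inv:
  assumes "subgroup M (G1 \<times>\<times> G2)" "(a, b) \<in> M"
  shows "(inv\<^bsub>G1\<^esub> a, inv\<^bsub>G2\<^esub> b) \<in> M"
  using subgroup.m_inv_closed[OF assms] subgroup_carrier[OF assms]
  by (simp add: inv_DirProd G1.group_axioms G2.group_axioms)

lemma subgroup_fst:
  assumes M: "subgroup M (G1 \<times>\<times> G2)" shows "subgroup (fst ` M) G1"
proof (rule G1.subgroupI)
  show "fst ` M \<subseteq> carrier G1" using subgroup_carrier[OF M] by auto
  show "fst ` M \<noteq> {}" using subgroup_one[OF M] by auto
next
  fix a assume "a \<in> fst ` M"
  then show "inv\<^bsub>G1\<^esub> a \<in> fst ` M" using subgroup_inv[OF M] by force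
next
  fix a b assume "a \<in> fst ` M" "b \<in> fst ` M"
  then show "a \<otimes>\<^bsub>G1\<^esub> b \<in> fst ` M" using subgroup_mult[OF M] by force
qed

lemma subgroup_snd:
  assumes M: "subgroup M (G1 \<times>\<times> G2)" shows "subgroup (snd ` M) G2"
proof (rule G2.subgroupI)
  show "snd ` M \<subseteq> carrier G2" using subgroup_carrier[OF M] by auto
  show "snd ` M \<noteq> {}" using subgroup_one[OF M] by auto
next
  fix a assume "a \<in> snd ` M"
  then show "inv\<^bsub>G2\<^esub> a \<in> snd ` M" using subgroup_inv[OF M] by force
next
  fix a b assume "a \<in> snd ` M" "b \<in> snd ` M"
  then show "a \<otimes>\<^bsub>G2\<^esub> b \<in> snd ` M" using subgroup_mult[OF M] by force
qed

text \<open>Conjugating \<open>(k, \<one>)\<close> by a pair \<open>(a, b)\<close> of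
  \<open>M\<close> gives a pair of \<open>M\<close> with second coordinate
  \<open>b \<otimes> \<one> \<otimes> inv b = \<one>\<close>, whence normality.\<close>

lemma section_ker1:
  assumes M: "subgroup M (G1 \<times>\<times> G2)" shows "is_section G1 (fst ` M) (ker1 G2 M)"
proof (rule G1.is_sectionI[OF subgroup_fst[OF M]])
  show "subgroup (ker1 G2 M) G1"
    unfolding ker1_def
    using subgroup_carrier[OF M] subgroup_one[OF M] subgroup_inv[OF M, of _ "\<one>\<^bsub>G2\<^esub>"]
      subgroup_mult[OF M, of _ "\<one>\<^bsub>G2\<^esub>" _ "\<one>\<^bsub>G2\<^esub>"]
    by (intro G1.subgroupI) auto
  show "ker1 G2 M \<subseteq> fst ` M" by (force simp: ker1_def)
  fix a k assume "a \<in> fst ` M" "k \<in> ker1 G2 M"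
  then obtain b where ab: "(a, b) \<in> M" and k: "(k, \<one>\<^bsub>G2\<^esub>) \<in> M" by (auto simp: ker1_def)
  show "a \<otimes>\<^bsub>G1\<^esub> k \<otimes>\<^bsub>G1\<^esub> inv\<^bsub>G1\<^esub> a \<in> ker1 G2 M"
    using subgroup_mult[OF M subgroup_mult[OF M ab k] subgroup_inv[OF M ab]]
      subgroup_carrier[OF M ab] by (simp add: ker1_def)
qed

lemma section_ker2:
  assumes M: "subgroup M (G1 \<times>\<times> G2)" shows "is_section G2 (snd ` M) (ker2 G1 M)"
proof (rule G2.is_sectionI[OF subgroup_snd[OF M]])
  show "subgroup (ker2 G1 M) G2"
    unfolding ker2_def
    using subgroup_carrier[OF M] subgroup_one[OF M] subgroup_inv[OF M, of "\<one>\<^bsub>G1\<^esub>"]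
      subgroup_mult[OF M, of "\<one>\<^bsub>G1\<^esub>" _ "\<one>\<^bsub>G1\<^esub>"]
    by (intro G2.subgroupI) auto
  show "ker2 G1 M \<subseteq> snd ` M" by (force simp: ker2_def)
  fix b k assume "b \<in> snd ` M" "k \<in> ker2 G1 M"
  then obtain a where ab: "(a, b) \<in> M" and k: "(\<one>\<^bsub>G1\<^esub>, k) \<in> M" by (auto simp: ker2_def)
  show "b \<otimes>\<^bsub>G2\<^esub> k \<otimes>\<^bsub>G2\<^esub> inv\<^bsub>G2\<^esub> b \<in> ker2 G1 M"
    using subgroup_mult[OF M subgroup_mult[OF M ab k] subgroup_inv[OF M ab]]
      subgroup_carrier[OF M ab] by (simp add: ker2_def)
qed

text \<open>Multiplying \<open>(a, b)\<close> by the inverse of \<open>(a, \<one>)\<close> leaves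
  \<open>(\<one>, b)\<close>, and multiplying it by the inverse of \<open>(\<one>, b)\<close> leaves
  \<open>(a, \<one>)\<close>.\<close>

lemma mem_ker1_iff_mem_ker2:
  assumes M: "subgroup M (G1 \<times>\<times> G2)" and ab: "(a, b) \<in> M"
  shows "a \<in> ker1 G2 M \<longleftrightarrow> b \<in> ker2 G1 M"
proof -
  have "(\<one>\<^bsub>G1\<^esub>, b) \<in> M" if "(a, \<one>\<^bsub>G2\<^esub>) \<in> M"
    using subgroup_mult[OF M subgroup_inv[OF M that] ab] subgroup_carrier[OF M ab] by simp
  moreover have "(a, \<one>\<^bsub>G2\<^esub>) \<in> M" if "(\<one>\<^bsub>G1\<^esub>, b) \<in> M"
    using subgroup_mult[OF M subgroup_inv[OF M that] ab] subgroup_carrier[OF M ab] by simp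
  ultimately show ?thesis by (auto simp: ker1_def ker2_def)
qed

text \<open>This is the previous equivalence for the quotient of the two pairs. One direction makes
  the correspondence of cosets well defined, the other makes it injective.\<close>

lemma coset_ker1_eq_iff_coset_ker2_eq:
  assumes M: "subgroup M (G1 \<times>\<times> G2)" and ab: "(a, b) \<in> M" and cd: "(c, d) \<in> M"
  shows "ker1 G2 M #>\<^bsub>G1\<^esub> a = ker1 G2 M #>\<^bsub>G1\<^esub> c \<longleftrightarrow> ker2 G1 M #>\<^bsub>G2\<^esub> b = ker2 G1 M #>\<^bsub>G2\<^esub> d"
  using section_ker1[OF M] section_ker2[OF M] subgroup_carrier[OF M ab] subgroup_carrier[OF M cd]
    mem_ker1_iff_mem_ker2[OF M subgroup_mult[OF M ab subgroup_inv[OF M cd]]]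
  by (simp add: is_section_def G1.r_coset_eq_iff G2.r_coset_eq_iff)

text \<open>\<open>M\<close> is saturated modulo its second kernel: equality of cosets puts
  \<open>(\<one>, d \<otimes> inv b)\<close> into \<open>M\<close>, and multiplying it by
  \<open>(a, b)\<close> gives the desired pair.\<close>

lemma mem_if_r_coset_ker2_eq:
  assumes M: "subgroup M (G1 \<times>\<times> G2)" and ab: "(a, b) \<in> M" and d: "d \<in> carrier G2"
    and eq: "ker2 G1 M #>\<^bsub>G2\<^esub> d = ker2 G1 M #>\<^bsub>G2\<^esub> b"
  shows "(a, d) \<in> M"
proof -
  have "(\<one>\<^bsub>G1\<^esub>, d \<otimes>\<^bsub>G2\<^esub> inv\<^bsub>G2\<^esub> b) \<in> M"
    using eq section_ker2[OF M] subgroup_carrier[OF M ab] d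
    by (simp add: is_section_def G2.r_coset_eq_iff) (simp add: ker2_def)
  from subgroup_mult[OF M this ab] show ?thesis
    using subgroup_carrier[OF M ab] d by (simp add: G2.m_assoc)
qed

text \<open>No map is constructed here: any \<open>\<phi>\<close> whose values on cosets agree with
  the pairs of \<open>M\<close> is the Goursat isomorphism, whatever it does off the quotient. This
  form applies at once to the two maps of the theorem and to the canonical maps, all given by
  \<open>coset_map\<close>.\<close>

theorem goursat:
  assumes M: "subgroup M (G1 \<times>\<times> G2)"
    and \<phi>: "\<And>a b. (a, b) \<in> M \<Longrightarrow> \<phi> (ker1 G2 M #>\<^bsub>G1\<^esub> a) = ker2 G1 M #>\<^bsub>G2\<^esub> b"
  shows "section_iso G1 G2 (fst ` M) (ker1 G2 M) (snd ` M) (ker2 G1 M) \<phi>"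
    and "graph_of G1 G2 (fst ` M) (ker1 G2 M) (snd ` M) (ker2 G1 M) \<phi> = M"
proof -
  let ?Q1 = "quot G1 (fst ` M) (ker1 G2 M)" and ?Q2 = "quot G2 (snd ` M) (ker2 G1 M)"
  note s1 = section_ker1[OF M] and s2 = section_ker2[OF M]
  have "\<phi> \<in> hom ?Q1 ?Q2"
  proof (rule homI)
    fix x assume "x \<in> carrier ?Q1"
    then show "\<phi> x \<in> carrier ?Q2" by (force simp: quot_carrier \<phi>)
  next
    fix x y assume "x \<in> carrier ?Q1" "y \<in> carrier ?Q1"
    then obtain a b c d where x: "(a, b) \<in> M" "x = ker1 G2 M #>\<^bsub>G1\<^esub> a"
      and y: "(c, d) \<in> M" "y = ker1 G2 M #>\<^bsub>G1\<^esub> c"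
      by (auto simp: quot_carrier)
    have mem: "a \<in> fst ` M" "c \<in> fst ` M" "b \<in> snd ` M" "d \<in> snd ` M" using x y by force+
    show "\<phi> (x \<otimes>\<^bsub>?Q1\<^esub> y) = \<phi> x \<otimes>\<^bsub>?Q2\<^esub> \<phi> y"
      using \<phi>[OF subgroup_mult[OF M x(1) y(1)]] \<phi>[OF x(1)] \<phi>[OF y(1)] x(2) y(2) mem
      by (simp add: FactGroup_def G1.r_coset_mult[OF s1] G2.r_coset_mult[OF s2])
  qed
  moreover have "inj_on \<phi> (carrier ?Q1)"
  proof (rule inj_onI)
    fix x y assume "x \<in> carrier ?Q1" "y \<in> carrier ?Q1" and eq: "\<phi> x = \<phi> y"
    then obtain a b c d where x: "(a, b) \<in> M" "x = ker1 G2 M #>\<^bsub>G1\<^esub> a"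
      and y: "(c, d) \<in> M" "y = ker1 G2 M #>\<^bsub>G1\<^esub> c"
      by (auto simp: quot_carrier)
    show "x = y"
      using coset_ker1_eq_iff_coset_ker2_eq[OF M x(1) y(1)] eq x(2) y(2) \<phi>[OF x(1)] \<phi>[OF y(1)]
      by simp
  qed
  moreover have "\<phi> ` carrier ?Q1 = carrier ?Q2"
  proof -
    have "\<phi> ` carrier ?Q1 = (\<lambda>z. \<phi> (ker1 G2 M #>\<^bsub>G1\<^esub> fst z)) ` M"
      by (simp add: quot_carrier image_image)
    also have "\<dots> = (\<lambda>z. ker2 G1 M #>\<^bsub>G2\<^esub> snd z) ` M" using \<phi> by (intro image_cong) auto
    finally show ?thesis by (simp add: quot_carrier image_image)
  qed
  ultimately show "section_iso G1 G2 (fst ` M) (ker1 G2 M) (snd ` M) (ker2 G1 M) \<phi>"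
    using s1 s2 by (simp add: section_iso_def iso_def bij_betw_def)
  show "graph_of G1 G2 (fst ` M) (ker1 G2 M) (snd ` M) (ker2 G1 M) \<phi> = M"
  proof
    show "graph_of G1 G2 (fst ` M) (ker1 G2 M) (snd ` M) (ker2 G1 M) \<phi> \<subseteq> M"
    proof (rule subrelI)
      fix a d assume ad: "(a, d) \<in> graph_of G1 G2 (fst ` M) (ker1 G2 M) (snd ` M) (ker2 G1 M) \<phi>"
      \<comment> \<open>Here \<open>b\<close> is a partner of \<open>a\<close> in \<open>M\<close>,
        to be compared with \<open>d\<close>; the pair with \<open>c\<close> serves to place
        \<open>d\<close> in \<open>carrier G2\<close>.\<close>
      then obtain b c where b: "(a, b) \<in> M" and c: "(c, d) \<in> M" by (auto simp: graph_of_def)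
      have "ker2 G1 M #>\<^bsub>G2\<^esub> d = ker2 G1 M #>\<^bsub>G2\<^esub> b" using ad \<phi>[OF b] by (simp add: graph_of_def)
      then show "(a, d) \<in> M"
        by (rule mem_if_r_coset_ker2_eq[OF M b subgroup_carrier(2)[OF M c]])
    qed
    show "M \<subseteq> graph_of G1 G2 (fst ` M) (ker1 G2 M) (snd ` M) (ker2 G1 M) \<phi>"
      using \<phi> by (force simp: graph_of_def)
  qed
qed

text \<open>The relation \<open>R\<close> may be smaller than \<open>M\<close>, as long as it
  represents every coset of the first kernel. All pairs of \<open>M\<close> over one coset have the
  same image coset, so \<open>R\<close> defines the map belonging to \<open>M\<close>.\<close>

lemma coset_map_ker:
  assumes M: "subgroup M (G1 \<times>\<times> G2)"
    and R: "\<And>p q. R p q \<Longrightarrow> (p, q) \<in> M"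
    and cover: "\<And>a. a \<in> fst ` M \<Longrightarrow> \<exists>p q. R p q \<and> a \<in> ker1 G2 M #>\<^bsub>G1\<^esub> p"
    and ab: "(a, b) \<in> M"
  shows "coset_map G1 (ker1 G2 M) G2 (ker2 G1 M) R (ker1 G2 M #>\<^bsub>G1\<^esub> a) = ker2 G1 M #>\<^bsub>G2\<^esub> b"
proof -
  obtain p q where pq: "R p q" and a: "a \<in> ker1 G2 M #>\<^bsub>G1\<^esub> p" using cover ab by force
  have "ker1 G2 M #>\<^bsub>G1\<^esub> p = ker1 G2 M #>\<^bsub>G1\<^esub> a"
    using G1.repr_independence[OF a] section_ker1[OF M] subgroup_carrier[OF M R[OF pq]]
    by (simp add: is_section_def)
  moreover from this have "ker2 G1 M #>\<^bsub>G2\<^esub> q = ker2 G1 M #>\<^bsub>G2\<^esub> b"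
    using coset_ker1_eq_iff_coset_ker2_eq[OF M R[OF pq] ab] by simp
  moreover have "coset_map G1 (ker1 G2 M) G2 (ker2 G1 M) R (ker1 G2 M #>\<^bsub>G1\<^esub> p) = ker2 G1 M #>\<^bsub>G2\<^esub> q"
    by (rule coset_map_eqI[of R, OF pq]) (metis coset_ker1_eq_iff_coset_ker2_eq[OF M] R pq)
  ultimately show ?thesis by simp
qed

text \<open>The converse half of Goursat's correspondence. It ties the section data of an
  isomorphism to the projections and kernels in terms of which the three order relations are
  defined.\<close>

lemma section_iso_graph:
  assumes "section_iso G1 G2 P1 K1 P2 K2 \<theta>"
  defines "M \<equiv> graph_of G1 G2 P1 K1 P2 K2 \<theta>"
  shows "fst ` M = P1" "snd ` M = P2" "ker1 G2 M = K1" "ker2 G1 M = K2"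
proof -
  have s1: "is_section G1 P1 K1" and s2: "is_section G2 P2 K2"
    and iso: "\<theta> \<in> iso (quot G1 P1 K1) (quot G2 P2 K2)"
    using assms(1) by (auto simp: section_iso_def)
  note sub = s1[unfolded is_section_def] s2[unfolded is_section_def]
  have bij: "inj_on \<theta> ((\<lambda>a. K1 #>\<^bsub>G1\<^esub> a) ` P1)"
    "\<theta> ` ((\<lambda>a. K1 #>\<^bsub>G1\<^esub> a) ` P1) = (\<lambda>b. K2 #>\<^bsub>G2\<^esub> b) ` P2"
    using iso by (auto simp: iso_def bij_betw_def quot_carrier)
  have "\<exists>b \<in> P2. (a, b) \<in> M" if "a \<in> P1" for a
  proof -
    have "\<theta> (K1 #>\<^bsub>G1\<^esub> a) \<in> (\<lambda>b. K2 #>\<^bsub>G2\<^esub> b) ` P2" using bij(2) that by blast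
    then show ?thesis using that by (auto simp: M_def graph_of_def)
  qed
  moreover have "\<exists>a \<in> P1. (a, b) \<in> M" if "b \<in> P2" for b
  proof -
    have "K2 #>\<^bsub>G2\<^esub> b \<in> \<theta> ` ((\<lambda>a. K1 #>\<^bsub>G1\<^esub> a) ` P1)" using bij(2) that by blast
    then show ?thesis using that by (auto simp: M_def graph_of_def)
  qed
  moreover have "M \<subseteq> P1 \<times> P2" by (auto simp: M_def graph_of_def)
  ultimately show "fst ` M = P1" "snd ` M = P2" by force+
  have one: "\<one>\<^bsub>G1\<^esub> \<in> P1" "\<one>\<^bsub>G2\<^esub> \<in> P2" using sub subgroup.one_closed by auto
  have K1: "K1 #>\<^bsub>G1\<^esub> \<one>\<^bsub>G1\<^esub> = K1" and K2: "K2 #>\<^bsub>G2\<^esub> \<one>\<^bsub>G2\<^esub> = K2"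
    using sub by (simp_all add: subgroup.subset)
  \<comment> \<open>The identity of each quotient is the subgroup factored out, so preservation of
    identities reads \<open>\<theta> K1 = K2\<close>. The second kernel follows from this directly,
    the first with injectivity.\<close>
  have "group_hom (quot G1 P1 K1) (quot G2 P2 K2) \<theta>"
    using iso sub by (simp add: group_hom_def group_hom_axioms_def iso_def normal.factorgroup_is_group)
  from group_hom.hom_one[OF this] have \<theta>1: "\<theta> K1 = K2" by simp
  have k1: "a \<in> K1 \<longleftrightarrow> K1 #>\<^bsub>G1\<^esub> a = K1" if "a \<in> P1" for a
    using sub subgroup.mem_carrier[OF _ that] G1.coset_join1[of K1 a] G1.coset_join2[of a K1] by metis
  have k2: "b \<in> K2 \<longleftrightarrow> K2 #>\<^bsub>G2\<^esub> b = K2" if "b \<in> P2" for b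
    using sub subgroup.mem_carrier[OF _ that] G2.coset_join1[of K2 b] G2.coset_join2[of b K2] by metis
  have inj: "\<theta> (K1 #>\<^bsub>G1\<^esub> a) = K2 \<longleftrightarrow> K1 #>\<^bsub>G1\<^esub> a = K1" if "a \<in> P1" for a
    using inj_on_eq_iff[OF bij(1), of "K1 #>\<^bsub>G1\<^esub> a" "K1 #>\<^bsub>G1\<^esub> \<one>\<^bsub>G1\<^esub>"] that one(1) K1 \<theta>1 by auto
  have "ker1 G2 M = {a \<in> P1. \<theta> (K1 #>\<^bsub>G1\<^esub> a) = K2}"
    using one(2) K2 by (simp add: ker1_def M_def graph_of_def)
  also have "\<dots> = {a \<in> P1. a \<in> K1}" using inj k1 by (intro Collect_cong) metis
  finally show "ker1 G2 M = K1" using G1.section_subset[OF s1] by blast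
  have "ker2 G1 M = {b \<in> P2. K2 = K2 #>\<^bsub>G2\<^esub> b}"
    using one(1) K1 \<theta>1 by (simp add: ker2_def M_def graph_of_def)
  also have "\<dots> = {b \<in> P2. b \<in> K2}" using k2 by (intro Collect_cong) metis
  finally show "ker2 G1 M = K2" using G2.section_subset[OF s2] by blast
qed

text \<open>Over a common first coordinate \<open>a\<close>, two second coordinates occurring in
  \<open>N\<close> differ by an element of its second kernel. That kernel is also the one of
  \<open>M\<close>, so a single partner of \<open>a\<close> in \<open>M\<close> brings in all its
  partners from \<open>N\<close>.\<close>

lemma subgroup_eqI:
  assumes M: "subgroup M (G1 \<times>\<times> G2)" and N: "subgroup N (G1 \<times>\<times> G2)"
    and "M \<subseteq> N" "fst ` M = fst ` N" and k: "ker2 G1 M = ker2 G1 N"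
  shows "M = N"
proof
  show "N \<subseteq> M"
  proof (rule subrelI)
    fix a b assume ab: "(a, b) \<in> N"
    then have "a \<in> fst ` M" using assms(4) by force
    then obtain c where ac: "(a, c) \<in> M" by auto
    have "ker2 G1 M #>\<^bsub>G2\<^esub> b = ker2 G1 M #>\<^bsub>G2\<^esub> c"
      using coset_ker1_eq_iff_coset_ker2_eq[OF N ab, of a c] ac assms(3) k by auto
    then show "(a, b) \<in> M"
      using mem_if_r_coset_ker2_eq[OF M ac] subgroup_carrier[OF N ab] by simp
  qed
qed fact

end

section \<open>Canonical maps between quotients\<close>

context group
begin

text \<open>As \<open>N \<subseteq> K\<close>, a coset of \<open>N\<close> determines the coset of
  \<open>K\<close> containing it, which is the well-definedness that the definite description
  needs.\<close>

lemma canonical_map_r_coset: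
  assumes "subgroup K G" "subgroup N G" "Q \<subseteq> carrier G" "N \<subseteq> K" "p \<in> Q"
  shows "canonical_map G Q N K (N #> p) = K #> p"
  unfolding canonical_map_def
  by (rule coset_map_eqI) (use assms r_coset_eq_iff in \<open>auto simp: subset_iff\<close>)

text \<open>Instance of \<open>goursat\<close> for the subgroup of all \<open>(a, b) \<in> Q \<times> QK\<close> with \<open>Ka = Kb\<close>.\<close>

lemma canonical_map_iso:
  assumes s: "is_section G P K" and Q: "subgroup Q G" "Q \<subseteq> P"
  shows "canonical_map G Q (Q \<inter> K) K \<in> iso (quot G Q (Q \<inter> K)) (quot G (Q <#> K) K)"
proof -
  interpret group_pair G G by unfold_locales
  define M where "M = {(a, b) \<in> Q \<times> (Q <#> K). K #> a = K #> b}"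
  have P: "subgroup P G" and K: "subgroup K G" and n: "K \<lhd> G\<lparr>carrier := P\<rparr>"
    using s by (auto simp: is_section_def)
  note QK = section_set_mult[OF s Q]
  have QKs: "subgroup (Q <#> K) G" using QK by (simp add: is_section_def)
  note mem = subsetD[OF subgroup.subset[OF P]] subsetD[OF Q(2)] subsetD[OF QK(2)]
  have M: "subgroup M (G \<times>\<times> G)"
  proof (rule group.subgroupI[OF DirProd_group[OF group_axioms group_axioms]])
    show "M \<subseteq> carrier (G \<times>\<times> G)" using mem by (auto simp: M_def)
    show "M \<noteq> {}" using Q(1) QKs subgroup.one_closed by (fastforce simp: M_def)
  next
    fix x assume "x \<in> M"
    then obtain a b where x: "x = (a, b)" "a \<in> Q" "b \<in> Q <#> K" and eq: "K #> a = K #> b"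
      by (auto simp: M_def)
    have c: "a \<in> carrier G" "b \<in> carrier G" "inv a \<in> P"
      using x mem P by (auto simp: subgroup.m_inv_closed)
    \<comment> \<open>Inversion reverses products, so equality of right cosets does not pass to
      inverses by itself. Conjugating \<open>b \<otimes> inv a\<close> by \<open>inv a\<close>
      yields \<open>inv a \<otimes> b\<close>, the element that decides the equality for
      \<open>inv a\<close> and \<open>inv b\<close>; normality of \<open>K\<close> enters
      here.\<close>
    have "b \<otimes> inv a \<in> K" using eq c r_coset_eq_iff[OF K, of b a] by simp
    then have "inv a \<otimes> (b \<otimes> inv a) \<otimes> inv (inv a) \<in> K" by (rule section_conj[OF s c(3)])
    then have "K #> inv a = K #> inv b" using c r_coset_eq_iff[OF K, of "inv a" "inv b"]
      by (simp add: m_assoc)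
    then show "inv\<^bsub>G \<times>\<times> G\<^esub> x \<in> M"
      using x c Q(1) QKs by (simp add: M_def subgroup.m_inv_closed group_axioms)
  next
    fix x y assume "x \<in> M" "y \<in> M"
    then obtain a b c d where x: "x = (a, b)" "a \<in> Q" "b \<in> Q <#> K" "K #> a = K #> b"
      and y: "y = (c, d)" "c \<in> Q" "d \<in> Q <#> K" "K #> c = K #> d"
      by (auto simp: M_def)
    have "K #> (a \<otimes> c) = K #> (b \<otimes> d)"
      using x y mem r_coset_mult[OF s, of a c] r_coset_mult[OF s, of b d] by simp
    then show "x \<otimes>\<^bsub>G \<times>\<times> G\<^esub> y \<in> M"
      using x y Q(1) QKs by (simp add: M_def subgroup.m_closed)
  qed
  have in_K: "K #> a = K #> \<one> \<longleftrightarrow> a \<in> K" if "a \<in> P" for a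
    using r_coset_eq_iff[OF K, of a \<one>] mem(1)[OF that] by simp
  \<comment> \<open>The diagonal of \<open>Q\<close> has two uses: it fills the first projection,
    and it is the relation from which the canonical map is defined.\<close>
  have QM: "(a, a) \<in> M" if "a \<in> Q" for a
    using that set_mult_subset_left[OF Q(1) K] by (auto simp: M_def)
  have fst: "fst ` M = Q" using QM by (force simp: M_def)
  have "b \<in> snd ` M" if b: "b \<in> Q <#> K" for b
  proof -
    obtain p where p: "p \<in> Q" "b \<in> K #> p" using b mem_set_mult_iff_r_coset[OF s Q(2)] by blast
    then have "K #> p = K #> b" using repr_independence[OF p(2) _ K] mem by simp
    then have "(p, b) \<in> M" using b p by (simp add: M_def)
    then show ?thesis by force
  qed
  then have snd: "snd ` M = Q <#> K" by (auto simp: M_def)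
  have ker1: "ker1 G M = Q \<inter> K"
    using in_K mem(2) QKs subgroup.one_closed by (auto simp: ker1_def M_def)
  have "ker2 G M = {b \<in> Q <#> K. b \<in> K}"
    unfolding ker2_def M_def using Q(1) subgroup.one_closed[of Q G] in_K[OF mem(3)]
    by (intro Collect_cong) (simp add: eq_commute[of "K #> \<one>"] cong: conj_cong)
  then have ker2: "ker2 G M = K" using set_mult_subset_right[OF Q(1) K] by blast
  have "canonical_map G Q (Q \<inter> K) K (ker1 G M #> a) = ker2 G M #> b" if "(a, b) \<in> M" for a b
  proof -
    have "\<exists>p q. (p \<in> Q \<and> q = p) \<and> a \<in> ker1 G M #> p" if "a \<in> fst ` M" for a
      using that rcos_self[of a "ker1 G M"] section_ker1[OF M] mem fst by (auto simp: is_section_def)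
    then show ?thesis
      unfolding canonical_map_def ker1[symmetric]
      using coset_map_ker[OF M _ _ that, of "\<lambda>p q. p \<in> Q \<and> q = p"] QM ker2 by simp
  qed
  from goursat(1)[OF M, of "canonical_map G Q (Q \<inter> K) K", OF this] show ?thesis by (simp add: section_iso_def fst snd ker1 ker2)
qed

text \<open>Injectivity compares \<open>p\<close> in \<open>Q \<inter> K\<close> with
  \<open>\<one>\<close>: their cosets have the same image, so \<open>p\<close> lies in
  \<open>N\<close>. Surjectivity gives each \<open>r\<close> in \<open>R\<close> a representative in
  \<open>Q\<close> modulo \<open>K\<close>, so \<open>r\<close> lies in \<open>QK\<close>.\<close>

lemma canonical_map_isoD:
  assumes s: "is_section G R K" and N: "subgroup N G" and Q: "subgroup Q G" "Q \<subseteq> R"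
    and NK: "N \<subseteq> K" and NQ: "N \<subseteq> Q"
    and iso: "canonical_map G Q N K \<in> iso (quot G Q N) (quot G R K)"
  shows "N = Q \<inter> K" and "R = Q <#> K"
proof -
  let ?f = "canonical_map G Q N K"
  have K: "subgroup K G" and R: "subgroup R G" using s by (auto simp: is_section_def)
  have f: "?f (N #> p) = K #> p" if "p \<in> Q" for p
    using canonical_map_r_coset K N subgroup.subset[OF Q(1)] NK that by blast
  have bij: "inj_on ?f ((\<lambda>a. N #> a) ` Q)" "?f ` ((\<lambda>a. N #> a) ` Q) = (\<lambda>a. K #> a) ` R"
    using iso by (auto simp: iso_def bij_betw_def quot_carrier)
  show "N = Q \<inter> K"
  proof
    show "Q \<inter> K \<subseteq> N"
    proof
      fix p assume p: "p \<in> Q \<inter> K"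
      have one: "\<one> \<in> Q" using Q(1) by (rule subgroup.one_closed)
      have c: "p \<in> carrier G" using p subgroup.mem_carrier[OF K] by simp
      have "K #> p = K #> \<one>" using p c r_coset_eq_iff[OF K c] by simp
      then have "N #> p = N #> \<one>"
        using inj_onD[OF bij(1), of "N #> p" "N #> \<one>"] p one f by simp
      then show "p \<in> N" using r_coset_eq_iff[OF N c] c by simp
    qed
  qed (use NK NQ in auto)
  show "R = Q <#> K"
  proof
    show "R \<subseteq> Q <#> K"
    proof
      fix r assume r: "r \<in> R"
      then obtain p where p: "p \<in> Q" "K #> r = K #> p"
      proof -
        have "K #> r \<in> ?f ` ((\<lambda>a. N #> a) ` Q)" using bij(2) r by blast
        then show thesis using that f by auto
      qed
      then have "r \<in> K #> p" using rcos_self[OF subgroup.mem_carrier[OF R r] K] by simp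
      then show "r \<in> Q <#> K" using mem_set_mult_iff_r_coset[OF s Q(2)] p by blast
    qed
    show "Q <#> K \<subseteq> R" using section_set_mult[OF s Q] by simp
  qed
qed

end

section \<open>Existence and uniqueness of the interpolating subgroups\<close>

theorem theorem5p6:
  fixes G1 :: "('a, 'm) monoid_scheme" and G2 :: "('b, 'n) monoid_scheme"
    and L L' :: "('a \<times> 'b) set"
    and P1 K1 P1' K1' :: "'a set" and P2 K2 P2' K2' :: "'b set"
    and \<theta> \<theta>' :: "'a set \<Rightarrow> 'b set"
  assumes "group G1" and "finite (carrier G1)"
    and "group G2" and "finite (carrier G2)"
    and "subgroup L (G1 \<times>\<times> G2)" and "subgroup L' (G1 \<times>\<times> G2)"
    and "section_iso G1 G2 P1 K1 P2 K2 \<theta>" and "L = graph_of G1 G2 P1 K1 P2 K2 \<theta>"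
    and "section_iso G1 G2 P1' K1' P2' K2' \<theta>'" and "L' = graph_of G1 G2 P1' K1' P2' K2' \<theta>'"
    and "L' \<subseteq> L"
  shows
    "let \<theta>hat = theta_hat G1 G2 K1 K2 P1' K1' P2' K2' \<theta>';
         \<theta>tilde = theta_tilde G1 G2 K1 K2 \<theta> P1' P2';
         Lhat = graph_of G1 G2 P1' (P1' \<inter> K1) P2' (P2' \<inter> K2) \<theta>hat;
         Ltilde = graph_of G1 G2 (P1' <#>\<^bsub>G1\<^esub> K1) K1 (P2' <#>\<^bsub>G2\<^esub> K2) K2 \<theta>tilde
     in
       (\<forall>p1 \<in> P1'. \<forall>p2 \<in> P2'. \<theta>' (K1' #>\<^bsub>G1\<^esub> p1) = K2' #>\<^bsub>G2\<^esub> p2 \<longrightarrow>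
          \<theta>hat ((P1' \<inter> K1) #>\<^bsub>G1\<^esub> p1) = (P2' \<inter> K2) #>\<^bsub>G2\<^esub> p2)
     \<and> (\<forall>p1 \<in> P1'. \<forall>p2 \<in> P2'. \<theta> (K1 #>\<^bsub>G1\<^esub> p1) = K2 #>\<^bsub>G2\<^esub> p2 \<longrightarrow>
          \<theta>tilde (K1 #>\<^bsub>G1\<^esub> p1) = K2 #>\<^bsub>G2\<^esub> p2)
     \<and> section_iso G1 G2 P1' (P1' \<inter> K1) P2' (P2' \<inter> K2) \<theta>hat
     \<and> section_iso G1 G2 (P1' <#>\<^bsub>G1\<^esub> K1) K1 (P2' <#>\<^bsub>G2\<^esub> K2) K2 \<theta>tilde
     \<and> subgroup Lhat (G1 \<times>\<times> G2) \<and> subgroup Ltilde (G1 \<times>\<times> G2)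
     \<and> le_P L' Lhat \<and> le_PK G1 G2 Lhat Ltilde \<and> le_K G1 G2 Ltilde L
     \<and> (\<forall>M N. subgroup M (G1 \<times>\<times> G2) \<and> subgroup N (G1 \<times>\<times> G2)
            \<and> le_P L' M \<and> le_PK G1 G2 M N \<and> le_K G1 G2 N L
          \<longrightarrow> M = Lhat \<and> N = Ltilde)"
proof -
  interpret group_pair G1 G2 using assms(1,3) by (simp add: group_pair_def)
  note L = assms(5) and L' = assms(6) and sub = assms(11)
  have s1: "is_section G1 P1 K1" and s2: "is_section G2 P2 K2"
    using assms(7) by (auto simp: section_iso_def)
  have s1': "is_section G1 P1' K1'" and s2': "is_section G2 P2' K2'"
    using assms(9) by (auto simp: section_iso_def)
  note pL = section_iso_graph[OF assms(7), folded assms(8)]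
  note pL' = section_iso_graph[OF assms(9), folded assms(10)]
  have P1': "subgroup P1' G1" and P2': "subgroup P2' G2"
    using s1' s2' by (auto simp: is_section_def)
  have K1: "subgroup K1 G1" and K2: "subgroup K2 G2"
    using s1 s2 by (auto simp: is_section_def)
  have le1: "P1' \<subseteq> P1" and le2: "P2' \<subseteq> P2" using sub pL(1,2) pL'(1,2) by auto
  have L_iff: "(a, b) \<in> L \<longleftrightarrow> a \<in> P1 \<and> b \<in> P2 \<and> \<theta> (K1 #>\<^bsub>G1\<^esub> a) = K2 #>\<^bsub>G2\<^esub> b" for a b
    using assms(8) by (auto simp: graph_of_def)
  have L'_iff: "(a, b) \<in> L' \<longleftrightarrow> a \<in> P1' \<and> b \<in> P2' \<and> \<theta>' (K1' #>\<^bsub>G1\<^esub> a) = K2' #>\<^bsub>G2\<^esub> b" for a b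
    using assms(10) by (auto simp: graph_of_def)
  define Q1 Q2 where "Q1 = P1' <#>\<^bsub>G1\<^esub> K1" and "Q2 = P2' <#>\<^bsub>G2\<^esub> K2"
  note q1 = G1.section_set_mult[OF s1 P1' le1, folded Q1_def]
  note q2 = G2.section_set_mult[OF s2 P2' le2, folded Q2_def]
  have sub_Q: "P1' \<subseteq> Q1" "K1 \<subseteq> Q1" "P2' \<subseteq> Q2" "K2 \<subseteq> Q2"
    using G1.set_mult_subset_left[OF P1' K1] G1.set_mult_subset_right[OF P1' K1]
      G2.set_mult_subset_left[OF P2' K2] G2.set_mult_subset_right[OF P2' K2]
    by (simp_all add: Q1_def Q2_def)
  have in_Q1: "a \<in> Q1 \<longleftrightarrow> (\<exists>p \<in> P1'. a \<in> K1 #>\<^bsub>G1\<^esub> p)" for a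
    unfolding Q1_def by (rule G1.mem_set_mult_iff_r_coset[OF s1 le1])
  have in_Q2: "a \<in> Q2 \<longleftrightarrow> (\<exists>p \<in> P2'. a \<in> K2 #>\<^bsub>G2\<^esub> p)" for a
    unfolding Q2_def by (rule G2.mem_set_mult_iff_r_coset[OF s2 le2])

  \<comment> \<open>The two rectangular cuts of \<open>L\<close>, their projections and
    kernels\<close>
  define A B where "A = L \<inter> (P1' \<times> P2')" and "B = L \<inter> (Q1 \<times> Q2)"
  have A: "subgroup A (G1 \<times>\<times> G2)" and B: "subgroup B (G1 \<times>\<times> G2)"
    unfolding A_def B_def using L P1' P2' q1(1) q2(1)
    by (auto simp: is_section_def intro!: group.subgroups_Inter_pair DirProd_subgroups
        DirProd_group G1.group_axioms G2.group_axioms)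
  have L'A: "L' \<subseteq> A" using sub by (auto simp: A_def L'_iff)
  have AB: "A \<subseteq> B" using sub_Q by (auto simp: A_def B_def)
  \<comment> \<open>The right-hand side is exactly the relation in \<open>theta_tilde\<close>: that
    map is defined from the pairs of \<open>A\<close>, although its graph will turn out to be
    \<open>B\<close>.\<close>
  have A_iff: "(a, b) \<in> A \<longleftrightarrow> a \<in> P1' \<and> b \<in> P2' \<and> \<theta> (K1 #>\<^bsub>G1\<^esub> a) = K2 #>\<^bsub>G2\<^esub> b" for a b
    using le1 le2 by (auto simp: A_def L_iff)
  have one: "\<one>\<^bsub>G1\<^esub> \<in> P1'" "\<one>\<^bsub>G2\<^esub> \<in> P2'" using P1' P2' by (auto simp: subgroup.one_closed)
  have L'1: "\<exists>b \<in> P2'. (a, b) \<in> L'" if "a \<in> P1'" for a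
  proof -
    have "a \<in> fst ` L'" using that pL'(1) by simp
    then obtain b where "(a, b) \<in> L'" by auto
    then show ?thesis using L'_iff by blast
  qed
  have L'2: "\<exists>a \<in> P1'. (a, b) \<in> L'" if "b \<in> P2'" for b
  proof -
    have "b \<in> snd ` L'" using that pL'(2) by simp
    then obtain a where "(a, b) \<in> L'" by auto
    then show ?thesis using L'_iff by blast
  qed
  \<comment> \<open>\<open>L'\<close> already projects onto \<open>P1'\<close> and
    \<open>P2'\<close>, and the rectangle allows no more. The kernels are those of \<open>L\<close>
    cut down to the rectangle, whose sides contain the identities.\<close>
  have pA: "fst ` A = P1'" "snd ` A = P2'" "ker1 G2 A = P1' \<inter> K1" "ker2 G1 A = P2' \<inter> K2"
  proof -
    have "P1' \<subseteq> fst ` A" "P2' \<subseteq> snd ` A"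
      using image_mono[OF L'A, of fst] image_mono[OF L'A, of snd] pL' by simp_all
    moreover have "fst ` A \<subseteq> P1'" "snd ` A \<subseteq> P2'" by (auto simp: A_def)
    ultimately show "fst ` A = P1'" "snd ` A = P2'" by blast+
    show "ker1 G2 A = P1' \<inter> K1" using pL(3) one by (auto simp: A_def ker1_def)
    show "ker2 G1 A = P2' \<inter> K2" using pL(4) one by (auto simp: A_def ker2_def)
  qed
  have pB: "fst ` B = Q1" "snd ` B = Q2" "ker1 G2 B = K1" "ker2 G1 B = K2"
  proof -
    have "a \<in> fst ` B" if a: "a \<in> Q1" for a
    proof -
      \<comment> \<open>The partner \<open>q\<close> of \<open>a\<close> is found through a
        representative \<open>p\<close> of \<open>a\<close> in \<open>P1'\<close> and a pair of
        \<open>L'\<close> above it. Replacing \<open>p\<close> by \<open>a\<close> keeps the coset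
        of \<open>K1\<close>, so \<open>(a, q)\<close> stays in \<open>L\<close>.\<close>
      obtain p q where p: "p \<in> P1'" "q \<in> P2'" "(p, q) \<in> L'" "a \<in> K1 #>\<^bsub>G1\<^esub> p"
        using a in_Q1 L'1 by blast
      then have "K1 #>\<^bsub>G1\<^esub> p = K1 #>\<^bsub>G1\<^esub> a"
        using G1.repr_independence[OF p(4) _ K1] subgroup_carrier[OF L' p(3)] by simp
      then have "(a, q) \<in> B"
        using p sub a q1(2) sub_Q L_iff[of p q] L_iff[of a q] by (auto simp: B_def)
      then show ?thesis by force
    qed
    then show "fst ` B = Q1" by (auto simp: B_def)
    have "b \<in> snd ` B" if b: "b \<in> Q2" for b
    proof -
      obtain p q where p: "p \<in> P1'" "q \<in> P2'" "(p, q) \<in> L'" "b \<in> K2 #>\<^bsub>G2\<^esub> q"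
        using b in_Q2 L'2 by blast
      then have "K2 #>\<^bsub>G2\<^esub> q = K2 #>\<^bsub>G2\<^esub> b"
        using G2.repr_independence[OF p(4) _ K2] subgroup_carrier[OF L' p(3)] by simp
      then have "(p, b) \<in> B"
        using p sub b q2(2) sub_Q L_iff[of p q] L_iff[of p b] by (auto simp: B_def)
      then show ?thesis by force
    qed
    then show "snd ` B = Q2" by (auto simp: B_def)
    \<comment> \<open>The sides of this rectangle contain \<open>K1\<close> and \<open>K2\<close>,
      so the kernels of \<open>L\<close> survive entirely.\<close>
    show "ker1 G2 B = K1" using pL(3) one sub_Q by (auto simp: B_def ker1_def)
    show "ker2 G1 B = K2" using pL(4) one sub_Q by (auto simp: B_def ker2_def)
  qed

  \<comment> \<open>Identification of the two maps with the Goursat isomorphisms of the cuts\<close>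
  define hat where "hat = theta_hat G1 G2 K1 K2 P1' K1' P2' K2' \<theta>'"
  define til where "til = theta_tilde G1 G2 K1 K2 \<theta> P1' P2'"
  \<comment> \<open>The defining relation is membership in \<open>L'\<close>, a subset of
    \<open>A\<close>. It suffices because every element of \<open>P1'\<close> has a partner in
    \<open>L'\<close>.\<close>
  have hat: "hat ((P1' \<inter> K1) #>\<^bsub>G1\<^esub> a) = (P2' \<inter> K2) #>\<^bsub>G2\<^esub> b" if "(a, b) \<in> A" for a b
    unfolding hat_def theta_hat_def pA(3,4)[symmetric] L'_iff[symmetric]
  proof (rule coset_map_ker[OF A _ _ that])
    fix a assume a: "a \<in> fst ` A"
    then obtain q where "(a, q) \<in> L'" using L'1 pA(1) by blast
    moreover have "a \<in> ker1 G2 A #>\<^bsub>G1\<^esub> a"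
      using G1.rcos_self[of a "ker1 G2 A"] section_ker1[OF A] subgroup.mem_carrier[OF P1'] a pA(1)
      by (simp add: is_section_def)
    ultimately show "\<exists>p q. (p, q) \<in> L' \<and> a \<in> ker1 G2 A #>\<^bsub>G1\<^esub> p" by blast
  qed (use L'A in auto)
  \<comment> \<open>The defining relation is membership in \<open>A\<close>, a subset of
    \<open>B\<close>. Each element of \<open>Q1\<close> agrees modulo \<open>K1\<close> with some
    \<open>p\<close> in \<open>P1'\<close>, and \<open>p\<close> has a partner in
    \<open>L' \<subseteq> A\<close>.\<close>
  have til: "til (K1 #>\<^bsub>G1\<^esub> a) = K2 #>\<^bsub>G2\<^esub> b" if "(a, b) \<in> B" for a b
    unfolding til_def theta_tilde_def A_iff[symmetric]
  proof (rule coset_map_ker[OF B _ _ that, unfolded pB(3,4)])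
    fix a assume "a \<in> fst ` B"
    then obtain p q where "(p, q) \<in> L'" "a \<in> K1 #>\<^bsub>G1\<^esub> p" using in_Q1 L'1 pB(1) by blast
    then show "\<exists>p q. (p, q) \<in> A \<and> a \<in> K1 #>\<^bsub>G1\<^esub> p" using L'A by blast
  qed (use AB in auto)
  have gA: "section_iso G1 G2 P1' (P1' \<inter> K1) P2' (P2' \<inter> K2) hat"
    "graph_of G1 G2 P1' (P1' \<inter> K1) P2' (P2' \<inter> K2) hat = A"
    using goursat[OF A, of hat] hat by (simp_all add: pA)
  have gB: "section_iso G1 G2 Q1 K1 Q2 K2 til" "graph_of G1 G2 Q1 K1 Q2 K2 til = B"
    using goursat[OF B, of til] til by (simp_all add: pB)

  \<comment> \<open>The chain of relations and its uniqueness\<close>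
  have PK: "le_PK G1 G2 A B"
    unfolding le_PK_def pA pB
    using AB G1.canonical_map_iso[OF s1 P1' le1] G2.canonical_map_iso[OF s2 P2' le2]
    by (simp add: Q1_def Q2_def)
  have unique: "M = A \<and> N = B"
    if M: "subgroup M (G1 \<times>\<times> G2)" and N: "subgroup N (G1 \<times>\<times> G2)"
      and le: "le_P L' M" "le_PK G1 G2 M N" "le_K G1 G2 N L" for M N
  proof -
    \<comment> \<open>Half of the data is immediate: \<open>le_P\<close> fixes the projections of
      \<open>M\<close> and \<open>le_K\<close> the kernels of \<open>N\<close>. The kernels of
      \<open>M\<close> and the projections of \<open>N\<close> are then forced by the canonical
      isomorphisms.\<close>
    have f: "fst ` M = P1'" "snd ` M = P2'" "ker1 G2 N = K1" "ker2 G1 N = K2"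
      and MN: "M \<subseteq> N" "N \<subseteq> L"
      using le pL pL' by (auto simp: le_P_def le_PK_def le_K_def)
    have k: "ker1 G2 M \<subseteq> K1" "ker2 G1 M \<subseteq> K2" "P1' \<subseteq> fst ` N" "P2' \<subseteq> snd ` N"
      using MN f by (auto simp: ker1_def ker2_def)
    have M1: "subgroup (ker1 G2 M) G1" "ker1 G2 M \<subseteq> P1'"
      and M2: "subgroup (ker2 G1 M) G2" "ker2 G1 M \<subseteq> P2'"
      using section_ker1[OF M] section_ker2[OF M] G1.section_subset G2.section_subset f
      by (auto simp: is_section_def)
    have iso1: "canonical_map G1 P1' (ker1 G2 M) K1 \<in> iso (quot G1 P1' (ker1 G2 M)) (quot G1 (fst ` N) K1)"
      and iso2: "canonical_map G2 P2' (ker2 G1 M) K2 \<in> iso (quot G2 P2' (ker2 G1 M)) (quot G2 (snd ` N) K2)"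
      using le(2) f by (simp_all add: le_PK_def)
    note d1 = G1.canonical_map_isoD[OF section_ker1[OF N, unfolded f] M1(1) P1' k(3) k(1) M1(2) iso1]
    note d2 = G2.canonical_map_isoD[OF section_ker2[OF N, unfolded f] M2(1) P2' k(4) k(2) M2(2) iso2]
    \<comment> \<open>A set of pairs lies in the product of its projections, which are now known to
      be the sides of the two rectangles. This gives the inclusions that \<open>subgroup_eqI\<close>
      turns into equalities.\<close>
    have "M \<subseteq> fst ` M \<times> snd ` M" "N \<subseteq> fst ` N \<times> snd ` N" by force+
    then have "M \<subseteq> A" "N \<subseteq> B"
      using MN d1(2) d2(2) f(1,2) unfolding A_def B_def Q1_def Q2_def by simp_all
    then show ?thesis
      using subgroup_eqI[OF M A] subgroup_eqI[OF N B] f pA pB d1(2) d2(1) by (simp add: Q1_def)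
  qed
  have "hat ((P1' \<inter> K1) #>\<^bsub>G1\<^esub> a) = (P2' \<inter> K2) #>\<^bsub>G2\<^esub> b"
    if "a \<in> P1'" "b \<in> P2'" "\<theta>' (K1' #>\<^bsub>G1\<^esub> a) = K2' #>\<^bsub>G2\<^esub> b" for a b
    using that L'A L'_iff by (intro hat) blast
  moreover have "til (K1 #>\<^bsub>G1\<^esub> a) = K2 #>\<^bsub>G2\<^esub> b"
    if "a \<in> P1'" "b \<in> P2'" "\<theta> (K1 #>\<^bsub>G1\<^esub> a) = K2 #>\<^bsub>G2\<^esub> b" for a b
    using that AB A_iff by (intro til) blast
  moreover have "le_P L' A" using L'A pA pL' by (simp add: le_P_def)
  moreover have "le_K G1 G2 B L" using pB pL by (simp add: le_K_def B_def)
  ultimately show ?thesis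
    unfolding Let_def hat_def[symmetric] til_def[symmetric] Q1_def[symmetric] Q2_def[symmetric] gA(2) gB(2)
    using gA(1) gB(1) A B PK unique by blast
qed

end
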